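(* Let $A\in\mathbb{R}^{n\times n}$ be a symmetric positive definite matrix and let $B\in\mathbb{R}^{m\times n}$ and $C\in\mathbb{R}^{p\times m}$ be full row rank matrices. Let $\alpha,\beta,\gamma>0$, let $P\in\mathbb{R}^{n\times n}$, $Q\in\mathbb{R}^{m\times m}$, $W\in\mathbb{R}^{p\times p}$ be symmetric positive definite matrices, let $\mathcal{P}_{EGSS}$ be the corresponding extensive generalized shift-splitting preconditioner, and let $\lambda$ be a real eigenvalue of the EGSS preconditioned matrix $\mathcal{P}_{EGSS}^{-1}\mathcal{A}$. Then $$\lambda\in\left(0,\ \frac{2\tilde\kappa_{\max}}{\alpha+\tilde\kappa_{\max}}\right],$$ where $\tilde\kappa_{\max}=\lambda_{\max}(P^{-1}A)$.
   Context: The saddle point matrix is $\mathcal{A}=\begin{bmatrix}A&B^T&0\\-B&0&-C^T\\0&C&0\end{bmatrix}$. The extensive generalized shift-splitting (EGSS) preconditioner is $$\mathcal{P}_{EGSS}=\frac12\begin{bmatrix}\alpha P+A&B^T&0\\-B&\beta Q&-C^T\\0&C&\gamma W\end{bmatrix}.$$ $\lambda_{\max}(\cdot)$ denotes the maximum eigenvalue of a matrix with real eigenvalues. *)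

theory Defs
  imports "HOL-Analysis.Analysis"
begin

text \<open>In HOL-Analysis, a \<open>k \<times> l\<close> matrix (\<open>k\<close> rows, \<open>l\<close> columns) has type \<open>real ^ 'l ^ 'k\<close>.\<close>

definition spd :: "real ^ 'n ^ 'n \<Rightarrow> bool" where
  "spd M \<longleftrightarrow> transpose M = M \<and> (\<forall>x. x \<noteq> 0 \<longrightarrow> x \<bullet> (M *v x) > 0)"

definition full_row_rank :: "real ^ 'l ^ 'k \<Rightarrow> bool" where
  "full_row_rank M \<longleftrightarrow> rank M = CARD('k)"

definition eigenvalue :: "'a::field ^ 'n ^ 'n \<Rightarrow> 'a \<Rightarrow> bool" where
  "eigenvalue M l \<longleftrightarrow> (\<exists>v. v \<noteq> 0 \<and> M *v v = l *s v)"

text \<open>The set below is always finite; it is nonempty, so that the maximum is meaningful, whenever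
  \<open>M\<close> has only real eigenvalues.\<close>

definition lambda_max :: "real ^ 'n ^ 'n \<Rightarrow> real" where
  "lambda_max M = Max {l. eigenvalue M l}"

text \<open>A \<open>3 \<times> 3\<close> block matrix; rows and columns are indexed by nested disjoint sums, with arguments
  listed row by row.\<close>

definition block3 ::
  "'a ^ 'n1 ^ 'm1 \<Rightarrow> 'a ^ 'n2 ^ 'm1 \<Rightarrow> 'a ^ 'n3 ^ 'm1 \<Rightarrow>
   'a ^ 'n1 ^ 'm2 \<Rightarrow> 'a ^ 'n2 ^ 'm2 \<Rightarrow> 'a ^ 'n3 ^ 'm2 \<Rightarrow>
   'a ^ 'n1 ^ 'm3 \<Rightarrow> 'a ^ 'n2 ^ 'm3 \<Rightarrow> 'a ^ 'n3 ^ 'm3 \<Rightarrow>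
   'a ^ ('n1 + 'n2 + 'n3) ^ ('m1 + 'm2 + 'm3)" where
  "block3 M11 M12 M13 M21 M22 M23 M31 M32 M33 = (\<chi> r s.
     case r of
       Inl i \<Rightarrow> (case s of Inl j \<Rightarrow> M11 $ i $ j | Inr (Inl j) \<Rightarrow> M12 $ i $ j | Inr (Inr j) \<Rightarrow> M13 $ i $ j)
     | Inr (Inl i) \<Rightarrow> (case s of Inl j \<Rightarrow> M21 $ i $ j | Inr (Inl j) \<Rightarrow> M22 $ i $ j | Inr (Inr j) \<Rightarrow> M23 $ i $ j)
     | Inr (Inr i) \<Rightarrow> (case s of Inl j \<Rightarrow> M31 $ i $ j | Inr (Inl j) \<Rightarrow> M32 $ i $ j | Inr (Inr j) \<Rightarrow> M33 $ i $ j))"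

definition saddle_mat ::
  "real ^ 'n ^ 'n \<Rightarrow> real ^ 'n ^ 'm \<Rightarrow> real ^ 'm ^ 'p \<Rightarrow> real ^ ('n + 'm + 'p) ^ ('n + 'm + 'p)" where
  "saddle_mat A B C = block3
     A     (transpose B) 0
     (- B) 0             (- transpose C)
     0     C             0"

definition egss_precond ::
  "real \<Rightarrow> real \<Rightarrow> real \<Rightarrow> real ^ 'n ^ 'n \<Rightarrow> real ^ 'm ^ 'm \<Rightarrow> real ^ 'p ^ 'p \<Rightarrow>
   real ^ 'n ^ 'n \<Rightarrow> real ^ 'n ^ 'm \<Rightarrow> real ^ 'm ^ 'p \<Rightarrow> real ^ ('n + 'm + 'p) ^ ('n + 'm + 'p)" where
  "egss_precond \<alpha> \<beta> \<gamma> P Q W A B C = (1 / 2) *\<^sub>R block3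
     (\<alpha> *\<^sub>R P + A) (transpose B) 0
     (- B)          (\<beta> *\<^sub>R Q)    (- transpose C)
     0              C             (\<gamma> *\<^sub>R W)"

end

theory Submission imports Defs begin

text \<open>An eigenpair satisfies \<open>\<A>v = \<lambda>\<P>v\<close> with \<open>v = (x, y, z)\<close>. As \<open>2\<P> - \<A>\<close> is the block diagonal
  matrix of \<open>\<alpha>P\<close>, \<open>\<beta>Q\<close>, \<open>\<gamma>W\<close>, this reads
  \<open>(2 - \<lambda>)\<A>v = \<lambda>(\<alpha>Px, \<beta>Qy, \<gamma>Wz)\<close>. Pairing with \<open>v\<close> cancels the skew-symmetric part of \<open>\<A>\<close>
  and leaves \<open>(2 - \<lambda>) x\<^sup>TAx = \<lambda>(\<alpha> x\<^sup>TPx + \<beta> y\<^sup>TQy + \<gamma> z\<^sup>TWz)\<close>, which forces \<open>0 < \<lambda> < 2\<close>.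
  The upper bound follows by dropping the last two terms and using
  \<open>x\<^sup>TAx \<le> \<kappa> x\<^sup>TPx\<close>, where the best constant \<open>\<kappa>\<close> (the maximum of the Rayleigh quotient) is the
  largest eigenvalue of \<open>P\<^sup>-\<^sup>1A\<close>.\<close>

section \<open>Symmetric, definite and semidefinite matrices\<close>

lemma inner_transpose:
  fixes M :: "real ^ 'l ^ 'k"
  shows "(transpose M *v x) \<bullet> y = x \<bullet> (M *v y)"
  by (simp add: dot_lmul_matrix transpose_matrix_vector)

lemma inner_symmetric:
  fixes M :: "real ^ 'n ^ 'n"
  assumes "transpose M = M"
  shows "x \<bullet> (M *v y) = y \<bullet> (M *v x)"
  using inner_transpose[of M x y] assms by (simp add: inner_commute)

lemma spd_symmetric: "spd M \<Longrightarrow> transpose M = M"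
  by (simp add: spd_def)

lemma spd_pos: "spd M \<Longrightarrow> x \<noteq> 0 \<Longrightarrow> x \<bullet> (M *v x) > 0"
  by (simp add: spd_def)

lemma spd_nonneg: "spd M \<Longrightarrow> x \<bullet> (M *v x) \<ge> 0"
  using spd_pos[of M x] by (cases "x = 0") simp_all

lemma spd_eq_0_iff: "spd M \<Longrightarrow> x \<bullet> (M *v x) = 0 \<longleftrightarrow> x = 0"
  using spd_pos[of M x] by (cases "x = 0") auto

text \<open>A definite form forces a trivial kernel. Symmetry is not assumed, so that the
  nonsymmetric preconditioner is covered as well as \<open>P\<close>.\<close>

lemma invertible_if_definite:
  fixes M :: "real ^ 'n ^ 'n"
  assumes "\<And>x. x \<noteq> 0 \<Longrightarrow> x \<bullet> (M *v x) > 0"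
  shows "invertible M"
proof -
  have "x = 0" if "M *v x = 0" for x
    using assms[of x] that by (cases "x = 0") auto
  then show ?thesis
    unfolding invertible_left_inverse matrix_left_invertible_ker by blast
qed

text \<open>Passing to the generalized eigenproblem removes the inverse. This serves both
  \<open>P\<close> with \<open>A\<close> and the preconditioner with the saddle point
  matrix.\<close>

lemma eigenvalue_matrix_inv_mult_iff:
  fixes M N :: "real ^ 'n ^ 'n"
  assumes "invertible M"
  shows "eigenvalue (matrix_inv M ** N) l \<longleftrightarrow> (\<exists>v. v \<noteq> 0 \<and> N *v v = l *\<^sub>R (M *v v))"
proof -
  have *: "M ** matrix_inv M = mat 1" "matrix_inv M ** M = mat 1"
    using someI_ex[OF assms[unfolded invertible_def]] by (simp_all add: matrix_inv_def)
  have "(matrix_inv M ** N) *v v = l *s v \<longleftrightarrow> N *v v = l *\<^sub>R (M *v v)" for v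
  proof
    assume "(matrix_inv M ** N) *v v = l *s v"
    then have "M *v ((matrix_inv M ** N) *v v) = l *\<^sub>R (M *v v)"
      by (simp add: scalar_mult_eq_scaleR matrix_vector_mult_scaleR)
    then show "N *v v = l *\<^sub>R (M *v v)"
      by (simp add: matrix_vector_mul_assoc matrix_mul_assoc *)
  next
    assume "N *v v = l *\<^sub>R (M *v v)"
    then have "matrix_inv M *v (N *v v) = l *\<^sub>R (matrix_inv M *v (M *v v))"
      by (simp add: matrix_vector_mult_scaleR)
    then show "(matrix_inv M ** N) *v v = l *s v"
      by (simp add: matrix_vector_mul_assoc * scalar_mult_eq_scaleR)
  qed
  then show ?thesis
    by (simp add: eigenvalue_def)
qed

text \<open>The transpose has the same rank, which is its number of columns, so it is
  injective.\<close>

lemma full_row_rank_transpose_ker: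
  fixes M :: "real ^ 'l ^ 'k"
  assumes "full_row_rank M" and "transpose M *v y = 0"
  shows "y = 0"
proof -
  have "inj ((*v) (transpose M))"
    using assms(1) by (simp add: full_row_rank_def rank_transpose flip: full_rank_injective)
  then show ?thesis
    using assms(2) by (metis injD matrix_vector_mult_0_right)
qed

text \<open>Minimality of the quadratic form at \<open>x\<close>, tested in the direction of \<open>M x\<close>.\<close>

lemma psd_ker:
  fixes M :: "real ^ 'n ^ 'n"
  assumes sym: "transpose M = M" and psd: "\<And>x. x \<bullet> (M *v x) \<ge> 0"
    and x: "x \<bullet> (M *v x) = 0"
  shows "M *v x = 0"
proof (rule ccontr)
  assume "M *v x \<noteq> 0"
  define y where "y = M *v x"
  define c where "c = y \<bullet> (M *v y)"
  \<comment> \<open>The form at \<open>x - s y\<close> is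
    \<open>s * (s * c - 2 * (y \<bullet> y))\<close>, negative for small positive \<open>s\<close>.
    This choice keeps \<open>s * c\<close> at most \<open>y \<bullet> y\<close>, and
    \<open>c + 1\<close> in the denominator allows \<open>c = 0\<close>.\<close>
  define s where "s = (y \<bullet> y) / (c + 1)"
  have yy: "y \<bullet> y > 0" and c: "c \<ge> 0"
    using \<open>M *v x \<noteq> 0\<close> psd by (simp_all add: y_def c_def)
  then have s: "s > 0" by (simp add: s_def)
  have "x \<bullet> (M *v y) = y \<bullet> y"
    using inner_symmetric[OF sym, of x y] by (simp add: y_def)
  then have "(x - s *\<^sub>R y) \<bullet> (M *v (x - s *\<^sub>R y)) = s * (s * c - 2 * (y \<bullet> y))"
    using x by (simp add: matrix_vector_mult_diff_distrib matrix_vector_mult_scaleR inner_diff_left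
        inner_diff_right c_def[symmetric] y_def[symmetric] algebra_simps)
  with psd[of "x - s *\<^sub>R y"] s have "s * c \<ge> 2 * (y \<bullet> y)"
    by (simp add: zero_le_mult_iff)
  moreover have "s * c \<le> s * (c + 1)" using s by simp
  moreover have "s * (c + 1) = y \<bullet> y" using c by (simp add: s_def)
  ultimately show False using yy by linarith
qed

section \<open>Generalized eigenvalues and the Rayleigh quotient\<close>

text \<open>A vector in the span of the others would be \<open>P\<close>-orthogonal to itself, hence
  zero.\<close>

lemma conjugate_independent:
  fixes P :: "real ^ 'n ^ 'n"
  assumes P: "spd P" and V: "pairwise (\<lambda>x y. x \<bullet> (P *v y) = 0) V" "0 \<notin> V"
  shows "independent V"
  unfolding dependent_def
proof clarify
  fix a assume a: "a \<in> V" "a \<in> span (V - {a})"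
  have "subspace {x. a \<bullet> (P *v x) = 0}"
    by (simp add: subspace_def matrix_vector_right_distrib matrix_vector_mult_scaleR inner_add_right)
  moreover have "V - {a} \<subseteq> {x. a \<bullet> (P *v x) = 0}"
    using V(1) a(1) by (auto simp: pairwise_def)
  ultimately have "a \<bullet> (P *v a) = 0"
    using a(2) span_minimal by blast
  then show False
    using a(1) V(2) P by (simp add: spd_eq_0_iff)
qed

text \<open>Finiteness is what makes \<open>Max\<close> in \<open>lambda_max\<close> an upper bound.
  Eigenvectors of distinct eigenvalues are \<open>P\<close>-conjugate, hence independent, and an
  independent set is finite.\<close>

lemma finite_generalized_eigenvalues:
  fixes A P :: "real ^ 'n ^ 'n"
  assumes P: "spd P" and A: "transpose A = A"
  shows "finite {l. \<exists>v. v \<noteq> 0 \<and> A *v v = l *\<^sub>R (P *v v)}" (is "finite ?E")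
proof -
  define e where "e l = (SOME v. v \<noteq> 0 \<and> A *v v = l *\<^sub>R (P *v v))" for l
  have e: "e l \<noteq> 0 \<and> A *v e l = l *\<^sub>R (P *v e l)" if "l \<in> ?E" for l
    unfolding e_def by (rule someI_ex) (use that in simp)
  \<comment> \<open>By symmetry of \<open>A\<close> and \<open>P\<close>, the number
    \<open>e k \<bullet> (A *v e l)\<close> is both \<open>l\<close> and \<open>k\<close> times
    \<open>e k \<bullet> (P *v e l)\<close>.\<close>
  have conj: "e k \<bullet> (P *v e l) = 0" if "k \<in> ?E" "l \<in> ?E" "k \<noteq> l" for k l
  proof -
    have "l * (e k \<bullet> (P *v e l)) = e k \<bullet> (A *v e l)"
      using e[OF that(2)] by simp
    also have "\<dots> = e l \<bullet> (A *v e k)"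
      by (rule inner_symmetric[OF A])
    also have "\<dots> = k * (e l \<bullet> (P *v e k))"
      using e[OF that(1)] by simp
    also have "\<dots> = k * (e k \<bullet> (P *v e l))"
      using inner_symmetric[OF spd_symmetric[OF P]] by simp
    finally show ?thesis
      using that(3) by simp
  qed
  have "pairwise (\<lambda>x y. x \<bullet> (P *v y) = 0) (e ` ?E)"
    unfolding pairwise_image by (intro pairwiseI impI conj)
  moreover have "0 \<notin> e ` ?E"
    using e by (simp add: image_iff)
  ultimately have "independent (e ` ?E)"
    by (rule conjugate_independent[OF P])
  then have "finite (e ` ?E)"
    by (rule independent_imp_finite)
  \<comment> \<open>A vector chosen for two distinct eigenvalues would be \<open>P\<close>-conjugate
    to itself.\<close>
  moreover have "inj_on e ?E"
  proof (rule inj_onI, rule ccontr)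
    fix k l assume kl: "k \<in> ?E" "l \<in> ?E" "e k = e l" "k \<noteq> l"
    then have "e l \<bullet> (P *v e l) = 0"
      using conj[of k l] by simp
    then show False
      using e[OF kl(2)] P by (simp add: spd_eq_0_iff)
  qed
  ultimately show ?thesis
    by (rule finite_imageD)
qed

text \<open>The quotient is continuous on the compact unit sphere and invariant under scaling, so
  its maximum there is global. Multiplying out the denominator admits \<open>y = 0\<close>.\<close>

lemma Rayleigh_quotient_attains_max:
  fixes A P :: "real ^ 'n ^ 'n"
  assumes P: "spd P"
  obtains x where "x \<noteq> 0"
    and "\<And>y. y \<bullet> (A *v y) \<le> (x \<bullet> (A *v x)) / (x \<bullet> (P *v x)) * (y \<bullet> (P *v y))"
proof -
  define q where "q y = (y \<bullet> (A *v y)) / (y \<bullet> (P *v y))" for y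
  let ?S = "sphere (0 :: real ^ 'n) 1"
  have "continuous_on ?S q"
    unfolding q_def
    by (intro continuous_intros linear_continuous_on linear_linear[THEN iffD2])
      (use P in \<open>auto simp: spd_eq_0_iff\<close>)
  then obtain x where x: "x \<in> ?S" and max: "\<And>y. y \<in> ?S \<Longrightarrow> q y \<le> q x"
    using continuous_attains_sup[OF compact_sphere] by (metis sphere_eq_empty not_one_less_zero)
  have "y \<bullet> (A *v y) \<le> q x * (y \<bullet> (P *v y))" for y
  proof (cases "y = 0")
    case False
    let ?u = "(1 / norm y) *\<^sub>R y"
    have "q ?u = q y"
      using False by (simp add: q_def matrix_vector_mult_scaleR)
    moreover have "q ?u \<le> q x"
      using False by (intro max) simp
    ultimately show ?thesis
      using spd_pos[OF P False] by (simp add: q_def pos_divide_le_eq)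
  qed simp
  then show thesis
    using x by (intro that[of x]) (auto simp: q_def)
qed

text \<open>If \<open>k\<close> is the maximal quotient, attained at \<open>x\<close>, then
  \<open>k P - A\<close> is positive semidefinite and its form vanishes at \<open>x\<close>. By
  \<open>psd_ker\<close> it annihilates \<open>x\<close>, so \<open>k\<close> is an eigenvalue and
  lies below the maximum.\<close>

lemma lambda_max_Rayleigh:
  fixes A P :: "real ^ 'n ^ 'n"
  assumes A: "transpose A = A" and P: "spd P"
  shows "y \<bullet> (A *v y) \<le> lambda_max (matrix_inv P ** A) * (y \<bullet> (P *v y))"
proof -
  obtain x where x: "x \<noteq> 0"
    and max: "\<And>y. y \<bullet> (A *v y) \<le> (x \<bullet> (A *v x)) / (x \<bullet> (P *v x)) * (y \<bullet> (P *v y))"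
    using Rayleigh_quotient_attains_max[OF P] by blast
  define k where "k = (x \<bullet> (A *v x)) / (x \<bullet> (P *v x))"
  let ?E = "{l. \<exists>v. v \<noteq> 0 \<and> A *v v = l *\<^sub>R (P *v v)}"
  define M where "M = k *\<^sub>R P - A"
  have M: "M *v y = k *\<^sub>R (P *v y) - A *v y" for y
    by (simp add: M_def matrix_vector_mult_diff_rdistrib scaleR_matrix_vector_assoc)
  have "transpose M = M"
    using A spd_symmetric[OF P] by (simp add: M_def transpose_def vec_eq_iff)
  moreover have "y \<bullet> (M *v y) \<ge> 0" for y
    using max[of y] by (simp add: M k_def inner_diff_right)
  moreover have "x \<bullet> (M *v x) = 0"
    using x P by (simp add: M k_def inner_diff_right spd_eq_0_iff)
  ultimately have "M *v x = 0"
    by (rule psd_ker)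
  then have "k \<in> ?E"
    using x by (auto simp: M)
  then have "k \<le> Max ?E"
    using finite_generalized_eigenvalues[OF P A] by simp
  also have "Max ?E = lambda_max (matrix_inv P ** A)"
    by (simp add: lambda_max_def eigenvalue_matrix_inv_mult_iff invertible_if_definite spd_pos[OF P])
  finally have "k * (y \<bullet> (P *v y)) \<le> lambda_max (matrix_inv P ** A) * (y \<bullet> (P *v y))"
    using spd_nonneg[OF P] by (rule mult_right_mono)
  then show ?thesis
    using max[of y] by (simp add: k_def)
qed

section \<open>Block vectors and block matrices\<close>

text \<open>The nesting of the index sums is that of \<open>block3\<close>, so that block matrices
  act componentwise.\<close>

definition vec3 :: "'a ^ 'n1 \<Rightarrow> 'a ^ 'n2 \<Rightarrow> 'a ^ 'n3 \<Rightarrow> 'a ^ ('n1 + 'n2 + 'n3)" where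
  "vec3 x y z = (\<chi> r. case r of Inl i \<Rightarrow> x $ i | Inr (Inl i) \<Rightarrow> y $ i | Inr (Inr i) \<Rightarrow> z $ i)"

lemma vec3_nth [simp]:
  "vec3 x y z $ Inl i = x $ i" "vec3 x y z $ Inr (Inl j) = y $ j" "vec3 x y z $ Inr (Inr k) = z $ k"
  by (simp_all add: vec3_def)

lemma all_sum3_iff: "(\<forall>r. R r) \<longleftrightarrow> (\<forall>i. R (Inl i)) \<and> (\<forall>j. R (Inr (Inl j))) \<and> (\<forall>k. R (Inr (Inr k)))"
  by (metis sum.exhaust)

lemma vec3_eq_iff [simp]: "vec3 x y z = vec3 x' y' z' \<longleftrightarrow> x = x' \<and> y = y' \<and> z = z'"
  by (simp add: vec_eq_iff all_sum3_iff)

lemma vec3_eq_0_iff [simp]: "vec3 x y z = 0 \<longleftrightarrow> x = 0 \<and> y = 0 \<and> z = 0"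
  by (simp add: vec_eq_iff all_sum3_iff)

lemma vec3_cases:
  obtains x y z where "v = vec3 x y z"
proof
  show "v = vec3 (\<chi> i. v $ Inl i) (\<chi> i. v $ Inr (Inl i)) (\<chi> i. v $ Inr (Inr i))"
    by (simp add: vec_eq_iff all_sum3_iff)
qed

lemma vec3_add: "vec3 x y z + vec3 x' y' z' = vec3 (x + x') (y + y') (z + z')"
  by (simp add: vec_eq_iff all_sum3_iff)

lemma sum_sum3:
  fixes f :: "'n1::finite + 'n2::finite + 'n3::finite \<Rightarrow> 'a::comm_monoid_add"
  shows "sum f UNIV =
    (\<Sum>i\<in>UNIV. f (Inl i)) + (\<Sum>i\<in>UNIV. f (Inr (Inl i))) + (\<Sum>i\<in>UNIV. f (Inr (Inr i)))"
  by (simp add: sum.Plus add.assoc flip: UNIV_Plus_UNIV)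

lemma inner_vec3: "vec3 x y z \<bullet> vec3 x' y' z' = x \<bullet> x' + y \<bullet> y' + z \<bullet> z'"
  by (simp add: inner_vec_def sum_sum3)

lemma block3_mult_vec3:
  "block3 M11 M12 M13 M21 M22 M23 M31 M32 M33 *v vec3 x y z =
    vec3 (M11 *v x + M12 *v y + M13 *v z)
      (M21 *v x + M22 *v y + M23 *v z)
      (M31 *v x + M32 *v y + M33 *v z)"
  unfolding vec_eq_iff all_sum3_iff by (simp add: matrix_vector_mult_def sum_sum3 block3_def)

lemma uminus_matrix_vector_mult:
  fixes M :: "real ^ 'l ^ 'k"
  shows "(- M) *v x = - (M *v x)"
  by (simp add: matrix_vector_mult_def vec_eq_iff sum_negf)

section \<open>The saddle point matrix and its preconditioner\<close>

lemma saddle_mat_mult_vec3: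
  "saddle_mat A B C *v vec3 x y z =
    vec3 (A *v x + transpose B *v y) (- (B *v x) - transpose C *v z) (C *v y)"
  by (simp add: saddle_mat_def block3_mult_vec3 uminus_matrix_vector_mult)

text \<open>Twice the preconditioner differs from the saddle point matrix only by the diagonal
  shifts.\<close>

lemma egss_precond_mult_vec3:
  "egss_precond \<alpha> \<beta> \<gamma> P Q W A B C *v vec3 x y z = (1 / 2) *\<^sub>R
    (saddle_mat A B C *v vec3 x y z + vec3 (\<alpha> *\<^sub>R (P *v x)) (\<beta> *\<^sub>R (Q *v y)) (\<gamma> *\<^sub>R (W *v z)))"
  by (simp add: egss_precond_def block3_mult_vec3 saddle_mat_mult_vec3 vec3_add
      uminus_matrix_vector_mult matrix_vector_mult_add_rdistrib ac_simps
      flip: scaleR_matrix_vector_assoc)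

text \<open>The \<open>B\<close> terms and the \<open>C\<close> terms each occur twice with opposite
  signs.\<close>

lemma inner_saddle_mat: "vec3 x y z \<bullet> (saddle_mat A B C *v vec3 x y z) = x \<bullet> (A *v x)"
proof -
  have "x \<bullet> (transpose B *v y) = y \<bullet> (B *v x)" "y \<bullet> (transpose C *v z) = z \<bullet> (C *v y)"
    using inner_transpose[of B y x] inner_transpose[of C z y] by (simp_all add: inner_commute)
  then show ?thesis
    by (simp add: saddle_mat_mult_vec3 inner_vec3 inner_add_right inner_diff_right)
qed

text \<open>This rules out the eigenvalue 0. The quadratic form gives \<open>x = 0\<close>, after
  which the first two block rows reduce to the kernels of the transposes of \<open>B\<close> and
  \<open>C\<close>.\<close>

lemma saddle_mat_ker:
  assumes "spd A" "full_row_rank B" "full_row_rank C" and ker: "saddle_mat A B C *v vec3 x y z = 0"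
  shows "x = 0 \<and> y = 0 \<and> z = 0"
proof -
  have "x = 0"
    using inner_saddle_mat[of x y z A B C] ker \<open>spd A\<close> by (simp add: spd_eq_0_iff)
  with ker have "transpose B *v y = 0" "transpose C *v z = 0"
    by (simp_all add: saddle_mat_mult_vec3)
  then show ?thesis
    using \<open>x = 0\<close> assms(2,3) by (blast dest: full_row_rank_transpose_ker)
qed

lemma block_diagonal_form_pos:
  fixes P :: "real ^ 'n ^ 'n" and Q :: "real ^ 'm ^ 'm" and W :: "real ^ 'p ^ 'p"
  assumes pos: "\<alpha> > 0" "\<beta> > 0" "\<gamma> > 0" and spd: "spd P" "spd Q" "spd W"
    and nz: "vec3 x y z \<noteq> 0"
  shows "\<alpha> * (x \<bullet> (P *v x)) + \<beta> * (y \<bullet> (Q *v y)) + \<gamma> * (z \<bullet> (W *v z)) > 0"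
proof -
  \<comment> \<open>The dimension \<open>'k\<close> stays generic so that the fact applies to all
    three blocks.\<close>
  have strict: "c * (v \<bullet> (M *v v)) > 0" if "c > 0" "spd M" "v \<noteq> 0"
    for c and M :: "real ^ 'k ^ 'k" and v
    using that(1) spd_pos[OF that(2,3)] by (rule mult_pos_pos)
  have nonneg: "c * (v \<bullet> (M *v v)) \<ge> 0" if "c > 0" "spd M" for c and M :: "real ^ 'k ^ 'k" and v
    using less_imp_le[OF that(1)] spd_nonneg[OF that(2)] by (rule mult_nonneg_nonneg)
  note nn = nonneg[OF pos(1) spd(1), of x] nonneg[OF pos(2) spd(2), of y] nonneg[OF pos(3) spd(3), of z]
  from nz consider "x \<noteq> 0" | "y \<noteq> 0" | "z \<noteq> 0"
    unfolding vec3_eq_0_iff by blast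
  then show ?thesis
  proof cases
    case 1
    show ?thesis using strict[OF pos(1) spd(1) 1] nn by linarith
  next
    case 2
    show ?thesis using strict[OF pos(2) spd(2) 2] nn by linarith
  next
    case 3
    show ?thesis using strict[OF pos(3) spd(3) 3] nn by linarith
  qed
qed

lemma inner_egss_precond:
  "vec3 x y z \<bullet> (egss_precond \<alpha> \<beta> \<gamma> P Q W A B C *v vec3 x y z) =
    (x \<bullet> (A *v x) + (\<alpha> * (x \<bullet> (P *v x)) + \<beta> * (y \<bullet> (Q *v y)) + \<gamma> * (z \<bullet> (W *v z)))) / 2"
  by (simp add: egss_precond_mult_vec3 inner_add_right inner_saddle_mat inner_vec3)

lemma invertible_egss_precond:
  assumes "\<alpha> > 0" "\<beta> > 0" "\<gamma> > 0" and "spd P" "spd Q" "spd W" and "spd A"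
  shows "invertible (egss_precond \<alpha> \<beta> \<gamma> P Q W A B C)"
proof (rule invertible_if_definite)
  fix v :: "real ^ ('a + 'b + 'c)"
  assume nz: "v \<noteq> 0"
  obtain x y z where v: "v = vec3 x y z"
    by (rule vec3_cases)
  show "v \<bullet> (egss_precond \<alpha> \<beta> \<gamma> P Q W A B C *v v) > 0"
    unfolding v inner_egss_precond
    by (rule half_gt_zero[OF add_nonneg_pos[OF spd_nonneg[OF assms(7)]
            block_diagonal_form_pos[OF assms(1-6) nz[unfolded v]]]])
qed

section \<open>Bounding the eigenvalue\<close>

text \<open>The scalar core of the argument: \<open>a\<close> and \<open>p\<close> stand for the
  forms of \<open>A\<close> and \<open>P\<close> at \<open>x\<close>, \<open>d\<close> for the
  weighted sum of the block forms, \<open>k\<close> for the largest eigenvalue. Positivity of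
  \<open>p\<close> is conditional because \<open>x = 0\<close> is not excluded beforehand.\<close>

lemma shift_splitting_bound:
  fixes a d k l p \<alpha> :: real
  assumes eq: "(2 - l) * a = l * d" and "l \<noteq> 0" and "a \<ge> 0" and "d > 0" and "\<alpha> > 0"
    and "\<alpha> * p \<le> d" and "a \<le> k * p" and p: "a > 0 \<Longrightarrow> p > 0"
  shows "0 < l \<and> l \<le> 2 * k / (\<alpha> + k)"
proof -
  have "l > 0"
  proof (rule ccontr)
    assume "\<not> l > 0"
    with \<open>l \<noteq> 0\<close> \<open>d > 0\<close> \<open>a \<ge> 0\<close> have "l * d < 0" "(2 - l) * a \<ge> 0"
      by (simp_all add: mult_neg_pos)
    with eq show False by simp
  qed
  then have "(2 - l) * a > 0"
    unfolding eq using \<open>d > 0\<close> by (rule mult_pos_pos)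
  with \<open>a \<ge> 0\<close> have "l < 2" "a > 0"
    by (auto simp: zero_less_mult_iff)
  note p = p[OF \<open>a > 0\<close>]
  have "k * p > 0"
    using \<open>a > 0\<close> \<open>a \<le> k * p\<close> by linarith
  with p have k: "k > 0"
    by (simp add: zero_less_mult_iff)
  have "l * (\<alpha> * p) \<le> l * d"
    using \<open>\<alpha> * p \<le> d\<close> \<open>l > 0\<close> by simp
  also have "\<dots> \<le> (2 - l) * (k * p)"
    unfolding eq[symmetric] using \<open>a \<le> k * p\<close> \<open>l < 2\<close> by simp
  finally have "(l * \<alpha>) * p \<le> ((2 - l) * k) * p"
    by (simp only: mult.assoc)
  \<comment> \<open>Cancelling \<open>p > 0\<close> leaves an inequality linear in \<open>l\<close>,
    solved by dividing by \<open>\<alpha> + k > 0\<close>.\<close>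
  then have "l * \<alpha> \<le> (2 - l) * k"
    using p by simp
  then show ?thesis
    using k \<open>\<alpha> > 0\<close> \<open>l > 0\<close> by (simp add: field_simps)
qed

theorem corollary4p2:
  fixes A P :: "real ^ 'n ^ 'n" and B :: "real ^ 'n ^ 'm" and C :: "real ^ 'm ^ 'p"
    and Q :: "real ^ 'm ^ 'm" and W :: "real ^ 'p ^ 'p"
    and \<alpha> \<beta> \<gamma> l :: real
  assumes "spd A" and "full_row_rank B" and "full_row_rank C"
    and "\<alpha> > 0" and "\<beta> > 0" and "\<gamma> > 0"
    and "spd P" and "spd Q" and "spd W"
    and "eigenvalue (matrix_inv (egss_precond \<alpha> \<beta> \<gamma> P Q W A B C) ** saddle_mat A B C) l"
  shows "l \<in> {0 <.. 2 * lambda_max (matrix_inv P ** A) / (\<alpha> + lambda_max (matrix_inv P ** A))}"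
proof -
  obtain v where "v \<noteq> 0"
    and v: "saddle_mat A B C *v v = l *\<^sub>R (egss_precond \<alpha> \<beta> \<gamma> P Q W A B C *v v)"
    using assms(10)
    unfolding eigenvalue_matrix_inv_mult_iff[OF invertible_egss_precond[OF assms(4-9,1)]] by blast
  obtain x y z where xyz: "v = vec3 x y z"
    by (rule vec3_cases)
  note nz = \<open>v \<noteq> 0\<close>[unfolded xyz] and eig = v[unfolded xyz]
  define a where "a = x \<bullet> (A *v x)"
  define p where "p = x \<bullet> (P *v x)"
  define d where "d = \<alpha> * p + \<beta> * (y \<bullet> (Q *v y)) + \<gamma> * (z \<bullet> (W *v z))"
  define k where "k = lambda_max (matrix_inv P ** A)"
  \<comment> \<open>Both sides of the generalized eigenvalue equation are paired with the
    eigenvector.\<close>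
  have "a = l * ((a + d) / 2)"
    using arg_cong[OF eig, of "\<lambda>w. vec3 x y z \<bullet> w"]
    unfolding inner_saddle_mat inner_scaleR_right inner_egss_precond a_def d_def p_def .
  then have eq: "(2 - l) * a = l * d"
    by (simp add: field_simps)
  have "l \<noteq> 0"
  proof
    assume "l = 0"
    then have "saddle_mat A B C *v vec3 x y z = 0"
      using eig by (simp only: scaleR_zero_left)
    from saddle_mat_ker[OF assms(1-3) this] nz show False
      by simp
  qed
  moreover have "a \<ge> 0"
    unfolding a_def using assms(1) by (rule spd_nonneg)
  moreover have "d > 0"
    unfolding d_def p_def using assms(4-9) nz by (rule block_diagonal_form_pos)
  moreover have "\<alpha> * p \<le> d"
    using mult_nonneg_nonneg[OF less_imp_le[OF assms(5)] spd_nonneg[OF assms(8), of y]]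
      mult_nonneg_nonneg[OF less_imp_le[OF assms(6)] spd_nonneg[OF assms(9), of z]]
    unfolding d_def by linarith
  moreover have "a \<le> k * p"
    unfolding a_def k_def p_def using spd_symmetric[OF assms(1)] assms(7) by (rule lambda_max_Rayleigh)
  moreover have "p > 0" if "a > 0"
  proof -
    have "x \<noteq> 0" using that by (auto simp: a_def)
    then show ?thesis unfolding p_def by (rule spd_pos[OF assms(7)])
  qed
  ultimately have "0 < l \<and> l \<le> 2 * k / (\<alpha> + k)"
    by (intro shift_splitting_bound[OF eq _ _ _ assms(4)])
  then show ?thesis
    by (simp only: k_def greaterThanAtMost_iff)
qed

end
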